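(* Consider a position in the incomplete-information deque sorting game in which the output is $1,2,\dots,t$, the deque is not a sandwich state, and a newly revealed input element $x$ must be placed at one end of the deque. The placement of $x$ is a substantive choice if and only if all of the following hold: (1) the deque already contains at least two elements, so that its two end elements are distinct; let $i$ be the smaller and $j$ the larger of the two end elements; (2) $x<i$ (so $x$ is smaller than both end elements); (3) $i-x\ge 3$, i.e. there are at least two values strictly between $x$ and $i$; (4) $x\neq t+1$, i.e. $x$ is not the next element required by the output; (5) some element larger than $i$ has not yet been revealed (is still in the input); (6) if the deque is non-monotonic, then some element $z$ with $i<z<j$ has not yet been revealed.
   Context: Sorting on a deque: the input is a permutation of $\{1,\dots,n\}$; allowed operations are moving the first input element to the left or right end of the deque, and moving the left or right end element of the deque to the end of the output; the goal is the output $1,2,\dots,n$. In the incomplete-information game, input elements are revealed one at a time, and the placement of a revealed element must be decided before any later input element is seen. A deque state is a sandwich state if some element of the deque has a larger element somewhere to its left and a larger element somewhere to its right. The deque is monotonic if its elements read from left to right are increasing or decreasing. Given a position as in the claim, a completion is an ordering of the not-yet-revealed elements as the rest of the input. The placement of $x$ is a substantive choice if there exists a completion which can be sorted (with complete information from then on) after placing $x$ at the end of the deque next to $i$ but not after placing it next to $j$, and also a completion which can be sorted after placing $x$ next to $j$ but not after placing it next to $i$. *)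

theory Defs
  imports Main
begin

text \<open>
  A configuration consists of the remaining input (its head comes first), the deque (read from
  left to right) and the output (its last entry was written last).
\<close>

type_synonym config = "nat list \<times> nat list \<times> nat list"

inductive deque_step :: "config \<Rightarrow> config \<Rightarrow> bool" where
  push_left: "deque_step (y # inp, d, out) (inp, y # d, out)"
| push_right: "deque_step (y # inp, d, out) (inp, d @ [y], out)"
| pop_left: "deque_step (inp, y # d, out) (inp, d, out @ [y])"
| pop_right: "deque_step (inp, d @ [y], out) (inp, d, out @ [y])"

definition can_be_sorted :: "nat \<Rightarrow> config \<Rightarrow> bool" where
  "can_be_sorted n c \<longleftrightarrow> deque_step\<^sup>*\<^sup>* c ([], [], [1..<Suc n])"

definition sandwich :: "nat list \<Rightarrow> bool" where
  "sandwich d \<longleftrightarrow>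
    (\<exists>p q r. p < q \<and> q < r \<and> r < length d \<and> d ! q < d ! p \<and> d ! q < d ! r)"

definition monotonic :: "nat list \<Rightarrow> bool" where
  "monotonic d \<longleftrightarrow> sorted_wrt (<) d \<or> sorted_wrt (>) d"

text \<open>
  A position of the game on \<open>{1..n}\<close>: the output is \<open>[1, ..., t]\<close>, the deque is \<open>d\<close>, and \<open>x\<close> has
  just been revealed and is about to be placed. Every such position is reachable: take an input
  that starts with \<open>1, ..., t\<close>, then \<open>d\<close>, then \<open>x\<close>.
\<close>

definition game_position :: "nat \<Rightarrow> nat \<Rightarrow> nat list \<Rightarrow> nat \<Rightarrow> bool" where
  "game_position n t d x \<longleftrightarrow>
    t \<le> n \<and> distinct d \<and> set d \<subseteq> {t<..n} \<and> x \<in> {t<..n} \<and> x \<notin> set d"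

definition unrevealed :: "nat \<Rightarrow> nat \<Rightarrow> nat list \<Rightarrow> nat \<Rightarrow> nat set" where
  "unrevealed n t d x = {1..n} - ({1..t} \<union> set d \<union> {x})"

definition completion :: "nat \<Rightarrow> nat \<Rightarrow> nat list \<Rightarrow> nat \<Rightarrow> nat list \<Rightarrow> bool" where
  "completion n t d x w \<longleftrightarrow> distinct w \<and> set w = unrevealed n t d x"

text \<open>
  The two placements are named by the end of the deque, left or right, rather than by the end
  element next to which \<open>x\<close> is put. The condition is symmetric in the two ends, so this is the
  same notion when the end elements differ, and it also makes sense for deques with fewer than
  two elements.
\<close>

definition substantive_choice :: "nat \<Rightarrow> nat \<Rightarrow> nat list \<Rightarrow> nat \<Rightarrow> bool" where
  "substantive_choice n t d x \<longleftrightarrow>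
    (\<exists>w. completion n t d x w
       \<and> can_be_sorted n (w, x # d, [1..<Suc t])
       \<and> \<not> can_be_sorted n (w, d @ [x], [1..<Suc t])) \<and>
    (\<exists>w. completion n t d x w
       \<and> can_be_sorted n (w, d @ [x], [1..<Suc t])
       \<and> \<not> can_be_sorted n (w, x # d, [1..<Suc t]))"

end

theory Submission
  imports Defs
begin

text \<open>
  A sandwich deque can never be emptied in order, while a non-sandwich deque has its minimum at an
  end; let \<open>i < j\<close> be the two end elements, so that \<open>i\<close> is the minimum. If one of the conditions
  fails, then one placement of \<open>x\<close> dominates the other, because any sorting after the latter can be
  mirrored: elements below \<open>i\<close> are exchanged between the two ends. If the conditions hold, pick
  \<open>z > i\<close> unrevealed, with \<open>z < j\<close> in the non-monotonic case. Revealing \<open>z\<close> and then the rest in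
  increasing order is fatal for \<open>x\<close> next to \<open>j\<close> only; revealing
  \<open>x + 2, t + 1, \<dots>, x - 1, z\<close> and then the rest in increasing order is fatal for \<open>x\<close> next to \<open>i\<close>
  only, since \<open>x + 2\<close> is then stuck on top of \<open>j\<close> when \<open>z\<close> arrives.
\<close>

section \<open>Sortability with the output recorded by its length\<close>

text \<open>Outputs are never withdrawn, so on the way to the sorted output only the next value may
  be popped, and \<open>t\<close> alone determines the output. Wrong pops are excluded by the
  rules.\<close>

inductive sortable :: "nat \<Rightarrow> nat \<Rightarrow> nat list \<Rightarrow> nat list \<Rightarrow> bool" for n where
  finished: "sortable n n [] []"
| push_l: "sortable n t w (y # d) \<Longrightarrow> sortable n t (y # w) d"
| push_r: "sortable n t w (d @ [y]) \<Longrightarrow> sortable n t (y # w) d"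
| pop_l: "sortable n (Suc t) w d \<Longrightarrow> sortable n t w (Suc t # d)"
| pop_r: "sortable n (Suc t) w d \<Longrightarrow> sortable n t w (d @ [Suc t])"

lemma deque_steps_output_extends:
  "deque_step\<^sup>*\<^sup>* c c' \<Longrightarrow> \<exists>s. snd (snd c') = snd (snd c) @ s"
proof (induction rule: rtranclp_induct)
  case (step c' c'')
  from step(2) have "\<exists>s. snd (snd c'') = snd (snd c') @ s"
    by cases auto
  with step.IH show ?case by auto
qed simp

text \<open>The output only grows by appending, so \<open>y\<close> must be the entry of the final
  list that follows \<open>t\<close>.\<close>

lemma next_output:
  assumes "deque_step\<^sup>*\<^sup>* (w, d, [1..<Suc t] @ [y]) ([], [], [1..<Suc n])"
  shows "y = Suc t"
proof -
  from deque_steps_output_extends[OF assms] obtain s where s: "[1..<Suc n] = [1..<Suc t] @ y # s"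
    by auto
  from arg_cong[OF s, of length] have "n = t + Suc (length s)"
    by (simp only: length_append length_upt length_Cons)
  then have "t < n"
    by simp
  moreover from arg_cong[OF s, of "\<lambda>l. l ! t"] have "[1..<Suc n] ! t = y"
    by (simp add: nth_append del: upt_Suc)
  ultimately show ?thesis
    by (simp del: upt_Suc)
qed

lemma sortable_if_can_be_sorted:
  assumes "deque_step\<^sup>*\<^sup>* c ([], [], [1..<Suc n])" and "c = (w, d, [1..<Suc t])"
  shows "sortable n t w d"
  using assms
proof (induction arbitrary: w d t rule: converse_rtranclp_induct)
  case base
  then have "[1..<Suc n] = [1..<Suc t]" by simp
  then have "n = t" by (metis diff_Suc_1 length_upt)
  with base show ?case by (auto intro: finished)
next
  case (step c c')
  from step.hyps(1) show ?case
  proof cases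
    case (pop_left inp y d' out)
    with step.prems step.hyps(2) have y: "y = Suc t" by (auto intro: next_output)
    have "c' = (w, d', [1..<Suc (Suc t)])" using pop_left y step.prems by simp
    from sortable.pop_l[OF step.IH[OF this]] show ?thesis using pop_left y step.prems by simp
  next
    case (pop_right inp d' y out)
    with step.prems step.hyps(2) have y: "y = Suc t" by (auto intro: next_output)
    have "c' = (w, d', [1..<Suc (Suc t)])" using pop_right y step.prems by simp
    from sortable.pop_r[OF step.IH[OF this]] show ?thesis using pop_right y step.prems by simp
  qed (use step in \<open>auto intro: sortable.push_l sortable.push_r\<close>)
qed

lemma can_be_sorted_if_sortable:
  "sortable n t w d \<Longrightarrow> deque_step\<^sup>*\<^sup>* (w, d, [1..<Suc t]) ([], [], [1..<Suc n])"
proof (induction rule: sortable.induct)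
  case (push_l t w y d)
  from deque_step.push_left push_l.IH show ?case by (rule converse_rtranclp_into_rtranclp)
next
  case (push_r t w d y)
  from deque_step.push_right push_r.IH show ?case by (rule converse_rtranclp_into_rtranclp)
next
  case (pop_l t w d)
  then have "deque_step\<^sup>*\<^sup>* (w, d, [1..<Suc t] @ [Suc t]) ([], [], [1..<Suc n])" by simp
  with deque_step.pop_left show ?case by (rule converse_rtranclp_into_rtranclp)
next
  case (pop_r t w d)
  then have "deque_step\<^sup>*\<^sup>* (w, d, [1..<Suc t] @ [Suc t]) ([], [], [1..<Suc n])" by simp
  with deque_step.pop_right show ?case by (rule converse_rtranclp_into_rtranclp)
qed simp

lemma can_be_sorted_iff_sortable: "can_be_sorted n (w, d, [1..<Suc t]) \<longleftrightarrow> sortable n t w d"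
  unfolding can_be_sorted_def
  using sortable_if_can_be_sorted can_be_sorted_if_sortable by blast

section \<open>Mirror symmetry and passing on the next output\<close>

lemma sortable_bound: "sortable n t w d \<Longrightarrow> y \<in> set w \<union> set d \<Longrightarrow> t < y"
  by (induction rule: sortable.induct) (auto dest: Suc_lessD)

lemma sortable_rev: "sortable n t w (rev d) \<longleftrightarrow> sortable n t w d"
proof -
  have "sortable n t w (rev d)" if "sortable n t w d" for d
    using that by (induction rule: sortable.induct) (auto intro: sortable.intros)
  from this[of d] this[of "rev d"] show ?thesis by auto
qed

text \<open>No other element can be popped before \<open>Suc t\<close>, so a sorting starts with
  pushes only; these can be replayed with \<open>Suc t\<close> already gone.\<close>

lemma sortable_remove_next:
  assumes "sortable n t w (A @ Suc t # B)"
  shows "sortable n (Suc t) w (A @ B)"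
  using assms
proof (induction t w "A @ Suc t # B" arbitrary: A B rule: sortable.induct)
  case (push_l t w y)
  from push_l.hyps(2)[of "y # A" B] show ?case by (auto intro: sortable.push_l)
next
  case (push_r t w y)
  from push_r.hyps(2)[of A "B @ [y]"] show ?case by (auto intro: sortable.push_r)
next
  case (pop_l t w d)
  then show ?case
    using sortable_bound[of n "Suc t" w d "Suc t"] by (cases A) auto
next
  case (pop_r t w d)
  then show ?case
    using sortable_bound[of n "Suc t" w d "Suc t"] by (cases B rule: rev_cases) auto
qed auto

lemma sortable_pass_next: "sortable n t (Suc t # w) d \<longleftrightarrow> sortable n (Suc t) w d"
proof
  assume "sortable n t (Suc t # w) d"
  then show "sortable n (Suc t) w d"
  proof cases
    case push_l
    then show ?thesis using sortable_remove_next[of n t w "[]" d] by simp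
  next
    case push_r
    then show ?thesis using sortable_remove_next[of n t w d "[]"] by simp
  next
    \<comment> \<open>A pop now would output \<open>Suc t\<close> while it is still in the
      input.\<close>
    case pop_l
    then show ?thesis using sortable_bound[of n "Suc t" "Suc t # w" _ "Suc t"] by fastforce
  next
    case pop_r
    then show ?thesis using sortable_bound[of n "Suc t" "Suc t # w" _ "Suc t"] by fastforce
  qed
qed (auto intro: pop_l push_l)

lemma sortable_pass_interval:
  "t \<le> s \<Longrightarrow> sortable n t ([Suc t..<Suc s] @ w) d \<longleftrightarrow> sortable n s w d"
proof (induction s arbitrary: w rule: dec_induct)
  case (step s)
  then show ?case using sortable_pass_next[of n s w d] by simp
qed simp

text \<open>While the next output is not in the deque, nothing can be popped.\<close>

lemma sortable_push_cases:
  assumes "sortable n t (y # w) d" "Suc t \<notin> set d"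
  obtains "sortable n t w (y # d)" | "sortable n t w (d @ [y])"
  using assms(1) by cases (use that assms(2) in auto)

section \<open>Sandwich states\<close>

lemma sandwich_append: "sandwich d \<Longrightarrow> sandwich (A @ d @ B)"
proof -
  assume "sandwich d"
  then obtain p q r where *: "p < q" "q < r" "r < length d" "d ! q < d ! p" "d ! q < d ! r"
    unfolding sandwich_def by blast
  show ?thesis unfolding sandwich_def
    by (rule exI[of _ "length A + p"], rule exI[of _ "length A + q"], rule exI[of _ "length A + r"])
      (use * in \<open>simp add: nth_append\<close>)
qed

lemma sandwich_rev: "sandwich (rev d) \<longleftrightarrow> sandwich d"
proof -
  have "sandwich (rev d)" if "sandwich d" for d
  proof -
    from that obtain p q r where *: "p < q" "q < r" "r < length d" "d ! q < d ! p" "d ! q < d ! r"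
      unfolding sandwich_def by blast
    show ?thesis unfolding sandwich_def
      by (rule exI[of _ "length d - Suc r"], rule exI[of _ "length d - Suc q"],
          rule exI[of _ "length d - Suc p"])
        (use * in \<open>auto simp: rev_nth Suc_diff_Suc\<close>)
  qed
  from this[of d] this[of "rev d"] show ?thesis by auto
qed

text \<open>A new left end can only serve as the larger element on the left.\<close>

lemma sandwich_Cons:
  "sandwich (a # d) \<longleftrightarrow> sandwich d \<or> (\<exists>q r. q < r \<and> r < length d \<and> d ! q < a \<and> d ! q < d ! r)"
proof
  assume "sandwich (a # d)"
  then obtain p q r where *: "p < q" "q < r" "r < length (a # d)"
    "(a # d) ! q < (a # d) ! p" "(a # d) ! q < (a # d) ! r"
    unfolding sandwich_def by blast
  then obtain q' r' where qr: "q = Suc q'" "r = Suc r'"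
    by (metis less_imp_Suc_add)
  show "sandwich d \<or> (\<exists>q r. q < r \<and> r < length d \<and> d ! q < a \<and> d ! q < d ! r)"
  proof (cases p)
    case 0
    with * qr show ?thesis by auto
  next
    case (Suc p')
    with * qr have "p' < q' \<and> q' < r' \<and> r' < length d \<and> d ! q' < d ! p' \<and> d ! q' < d ! r'" by simp
    then show ?thesis unfolding sandwich_def by blast
  qed
next
  assume "sandwich d \<or> (\<exists>q r. q < r \<and> r < length d \<and> d ! q < a \<and> d ! q < d ! r)"
  then show "sandwich (a # d)"
  proof
    assume "sandwich d"
    then show ?thesis using sandwich_append[of d "[a]" "[]"] by simp
  next
    assume "\<exists>q r. q < r \<and> r < length d \<and> d ! q < a \<and> d ! q < d ! r"
    then obtain q r where "q < r" "r < length d" "d ! q < a" "d ! q < d ! r" by blast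
    then show ?thesis unfolding sandwich_def
      by (intro exI[of _ 0] exI[of _ "Suc q"] exI[of _ "Suc r"]) simp
  qed
qed

lemma sandwichI: "a < b \<Longrightarrow> a < c \<Longrightarrow> sandwich (A @ b # B @ a # C @ c # D)"
  unfolding sandwich_def
  by (rule exI[of _ "length A"], rule exI[of _ "length A + Suc (length B)"],
      rule exI[of _ "length A + Suc (length B) + Suc (length C)"]) (simp add: nth_append)

lemma not_sandwich_Cons_min: "\<not> sandwich d \<Longrightarrow> \<forall>b\<in>set d. a < b \<Longrightarrow> \<not> sandwich (a # d)"
  unfolding sandwich_Cons by (metis less_trans nth_mem order_less_asym)

lemma min_at_end:
  assumes "\<not> sandwich d" "a \<in> set d" "\<forall>b\<in>set d. a \<le> b" "distinct d"
  shows "a = hd d \<or> a = last d"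
proof (rule ccontr)
  assume neg: "\<not> (a = hd d \<or> a = last d)"
  from assms(2) obtain A B where d: "d = A @ a # B" by (meson split_list)
  with neg obtain b A' c B' where "A = b # A'" "B = B' @ [c]"
    by (cases A; cases B rule: rev_cases) auto
  with d have *: "d = [] @ b # A' @ a # B' @ c # []" by simp
  with assms(3,4) have "a < b" "a < c" by (auto simp: less_le)
  from sandwichI[OF this, of "[]" A' B' "[]"] * assms(1) show False by simp
qed

text \<open>Pushes preserve a sandwich, and a popped element is the minimum, so it takes part in
  none as a larger neighbour and, being at an end, is not sandwiched itself.\<close>

lemma sandwich_not_sortable: "sortable n t w d \<Longrightarrow> \<not> sandwich d"
proof (induction rule: sortable.induct)
  case finished
  then show ?case by (simp add: sandwich_def)
next
  case (push_l t w y d)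
  then show ?case using sandwich_append[of d "[y]" "[]"] by auto
next
  case (push_r t w d y)
  then show ?case using sandwich_append[of d "[]" "[y]"] by auto
next
  case (pop_l t w d)
  then show ?case
    by (intro not_sandwich_Cons_min) (auto dest: sortable_bound)
next
  case (pop_r t w d)
  have "\<not> sandwich (Suc t # rev d)"
    using pop_r by (intro not_sandwich_Cons_min) (auto dest: sortable_bound simp: sandwich_rev)
  then show ?case using sandwich_rev[of "d @ [Suc t]"] by simp
qed

text \<open>
  Revealing the remaining elements in increasing order makes every non-sandwich deque sortable:
  the next output is always either at an end of the deque or the next input.
\<close>

lemma sortable_increasing_input:
  assumes "t \<le> n" "\<not> sandwich d" "distinct d" "set d \<subseteq> {t<..n}"
  shows "sortable n t (sorted_list_of_set ({t<..n} - set d)) d"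
  using assms
proof (induction t arbitrary: d rule: inc_induct)
  case base
  then show ?case by (auto intro: finished)
next
  case (step t)
  have interval: "{t<..n} = insert (Suc t) {Suc t<..n}" using step.hyps by auto
  show ?case
  proof (cases "Suc t \<in> set d")
    case True
    have "\<forall>b\<in>set d. Suc t \<le> b" using step.prems by auto
    from min_at_end[OF step.prems(1) True this step.prems(2)] True
    obtain e where e: "d = Suc t # e \<or> d = e @ [Suc t]"
      by (metis append_butlast_last_id empty_iff list.collapse list.set(1))
    have *: "\<not> sandwich e"
      using e step.prems(1) sandwich_append[of e "[Suc t]" "[]"] sandwich_append[of e "[]" "[Suc t]"]
      by auto
    have **: "set d = insert (Suc t) (set e)" "distinct e" "Suc t \<notin> set e"
      using e step.prems by auto
    have "set e \<subseteq> {Suc t<..n}" using ** step.prems(3) interval by auto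
    note step.IH[OF * **(2) this]
    moreover have "{t<..n} - set d = {Suc t<..n} - set e" using ** interval by auto
    ultimately show ?thesis using e by (auto intro: pop_l pop_r)
  next
    case False
    then have sub: "set d \<subseteq> {Suc t<..n}" using step.prems(3) interval by auto
    have eq: "{t<..n} - set d = insert (Suc t) ({Suc t<..n} - set d)" using False interval by auto
    have "sorted_list_of_set ({t<..n} - set d) = Suc t # sorted_list_of_set ({Suc t<..n} - set d)"
      unfolding eq by (subst sorted_list_of_set_insert_remove) (auto simp: insort_is_Cons)
    then show ?thesis
      using step.IH[OF step.prems(1,2) sub] by (simp add: sortable_pass_next)
  qed
qed

section \<open>Exchanging the two ends\<close>

text \<open>An element that \<open>d\<close> alone blocks stays blocked when stacks \<open>L\<close>
  and \<open>R\<close> surround \<open>d\<close>.\<close>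

lemma sandwich_Cons_insert: "sandwich (y # d) \<Longrightarrow> sandwich (y # L @ d @ R)"
proof -
  assume "sandwich (y # d)"
  then consider "sandwich d" | q r where "q < r" "r < length d" "d ! q < y" "d ! q < d ! r"
    unfolding sandwich_Cons by blast
  then show ?thesis
  proof cases
    case 1
    then show ?thesis using sandwich_append[of d "y # L" R] by simp
  next
    case 2
    then show ?thesis unfolding sandwich_Cons
      by (intro disjI2 exI[of _ "length L + q"] exI[of _ "length L + r"]) (simp add: nth_append)
  qed
qed

lemma sandwich_snoc_insert: "sandwich (d @ [y]) \<Longrightarrow> sandwich (L @ d @ R @ [y])"
  using sandwich_Cons_insert[of y "rev d" "rev R" "rev L"]
    sandwich_rev[of "d @ [y]"] sandwich_rev[of "L @ d @ R @ [y]"] by simp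

text \<open>
  The elements stacked on the two sides of \<open>d\<close> may be exchanged as long as every further element
  either goes on top of such a stack or cannot be placed at all before both stacks are gone.
\<close>

lemma sortable_flip:
  assumes "sortable n t w (L @ d @ R)" "d \<noteq> []"
    and "\<forall>a \<in> set L \<union> set R. \<forall>b \<in> set d. a < b"
    and "\<forall>y \<in> set w. (\<forall>b \<in> set d. y < b) \<or> sandwich (y # d) \<and> sandwich (d @ [y])"
  shows "sortable n t w (rev R @ d @ rev L)"
  using assms
proof (induction t w "L @ d @ R" arbitrary: L R rule: sortable.induct)
  case (push_l t w y)
  have "\<not> sandwich (y # d)"
    using sandwich_not_sortable[OF push_l.hyps(1)] sandwich_Cons_insert by blast
  with push_l.prems have "sortable n t w (rev R @ d @ rev (y # L))"
    by (intro push_l.hyps) auto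
  then show ?case using sortable.push_r[of n t w "rev R @ d @ rev L" y] by simp
next
  case (push_r t w y)
  have "\<not> sandwich (d @ [y])"
    using sandwich_not_sortable[OF push_r.hyps(1)] sandwich_snoc_insert by auto
  with push_r.prems have "sortable n t w (rev (R @ [y]) @ d @ rev L)"
    by (intro push_r.hyps) auto
  then show ?case using sortable.push_l[of n t w y "rev R @ d @ rev L"] by simp
next
  case (pop_l t w e)
  show ?case
  proof (cases L)
    case Nil
    show ?thesis
    proof (cases R)
      case Nil
      with \<open>L = []\<close> pop_l show ?thesis by (metis append.left_neutral append_Nil2 rev.simps(1) sortable.pop_l)
    next
      case (Cons r R')
      \<comment> \<open>With \<open>L\<close> empty the popped element comes from \<open>d\<close>,
        yet the smaller \<open>r\<close> still waits in the deque.\<close>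
      then have "r \<in> set e" "r < Suc t"
        using pop_l.hyps(3) pop_l.prems \<open>L = []\<close> by (auto simp: Cons_eq_append_conv)
      then show ?thesis using sortable_bound[OF pop_l.hyps(1)] by force
    qed
  next
    case (Cons a L')
    with pop_l have "sortable n (Suc t) w (rev R @ d @ rev L')" by auto
    then show ?thesis
      using Cons pop_l.hyps(3) sortable.pop_r[of n t w "rev R @ d @ rev L'"] by simp
  qed
next
  case (pop_r t w e)
  show ?case
  proof (cases R rule: rev_cases)
    case Nil
    show ?thesis
    proof (cases L)
      case Nil
      with \<open>R = []\<close> pop_r show ?thesis by (metis append.left_neutral append_Nil2 rev.simps(1) sortable.pop_r)
    next
      case (Cons r L')
      then have "r \<in> set e" "r < Suc t"
        using pop_r.hyps(3) pop_r.prems \<open>R = []\<close> by (auto simp: append_eq_append_conv2 append_eq_Cons_conv Cons_eq_append_conv)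
      then show ?thesis using sortable_bound[OF pop_r.hyps(1)] by force
    qed
  next
    case (snoc R' a)
    with pop_r have "sortable n (Suc t) w (rev R' @ d @ rev L)" by auto
    then show ?thesis
      using snoc pop_r.hyps(3) sortable.pop_l[of n t w "rev R' @ d @ rev L"] by simp
  qed
qed auto

text \<open>
  As long as \<open>x\<close> lies next to the larger end, no element above the smaller end can be placed. Once
  \<open>x\<close> is gone, the only element below the smaller end that can remain is \<open>x + 1\<close>, which is the
  next output.
\<close>

lemma sortable_move_to_smaller_end:
  assumes "sortable n t w (L @ (i # e @ [j]) @ x # R)" "i < j" "x < i" "i \<le> x + 2" "i \<notin> set w"
    and "\<forall>a \<in> set L \<union> set R. a < i"
  shows "sortable n t w (rev R @ x # (i # e @ [j]) @ rev L)"
  using assms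
proof (induction t w "L @ (i # e @ [j]) @ x # R" arbitrary: L R rule: sortable.induct)
  case (push_l t w y)
  \<comment> \<open>A larger \<open>y\<close> would put \<open>i\<close> between \<open>y\<close>
    and \<open>j\<close>; pushed on the right, it would put \<open>x\<close> between
    \<open>j\<close> and \<open>y\<close>.\<close>
  have "\<not> i < y"
    using sandwichI[of i y j "[]" L e "x # R"] sandwich_not_sortable[OF push_l.hyps(1)] push_l.prems
    by auto
  with push_l.prems have "sortable n t w (rev R @ x # (i # e @ [j]) @ rev (y # L))"
    by (intro push_l.hyps) auto
  then show ?case using sortable.push_r[of n t w "rev R @ x # (i # e @ [j]) @ rev L" y] by simp
next
  case (push_r t w y)
  have "\<not> i < y"
    using sandwichI[of x j y "L @ i # e" "[]" R "[]"] sandwich_not_sortable[OF push_r.hyps(1)]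
      push_r.prems by auto
  with push_r.prems have "sortable n t w (rev (R @ [y]) @ x # (i # e @ [j]) @ rev L)"
    by (intro push_r.hyps) auto
  then show ?case using sortable.push_l[of n t w y] by simp
next
  case (pop_l t w f)
  show ?case
  proof (cases L)
    case Nil
    then show ?thesis using pop_l sortable_bound[OF pop_l.hyps(1), of x] by auto
  next
    case (Cons a L')
    with pop_l have "sortable n (Suc t) w (rev R @ x # (i # e @ [j]) @ rev L')" by auto
    then show ?thesis
      using Cons pop_l.hyps(3) sortable.pop_r[of n t w "rev R @ x # (i # e @ [j]) @ rev L'"] by simp
  qed
next
  case (pop_r t w f)
  show ?case
  proof (cases R rule: rev_cases)
    case Nil
    with pop_r.hyps(3) have f: "f = L @ i # e @ [j]" and x: "x = Suc t"
      by (auto simp flip: append_assoc append_Cons)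
    have L: "a = Suc (Suc t)" if "a \<in> set L" for a
    proof -
      have "Suc t < a" using sortable_bound[OF pop_r.hyps(1), of a] f that by simp
      moreover have "a < i" using pop_r.prems that by auto
      ultimately show ?thesis using x pop_r.prems by linarith
    qed
    have "sortable n (Suc t) w ((i # e @ [j]) @ rev L)"
    proof (cases L)
      case Nil
      then show ?thesis using pop_r.hyps(1) f by simp
    next
      case (Cons a L')
      with L have "a = Suc (Suc t)" by simp
      with Cons have *: "sortable n (Suc (Suc t)) w (L' @ i # e @ [j])"
        using pop_r.hyps(1) f sortable_remove_next[of n "Suc t" w "[]" "L' @ i # e @ [j]"] by simp
      \<comment> \<open>Any element of \<open>L'\<close> would again be \<open>Suc (Suc t)\<close>,
        which has just been output.\<close>
      have "L' = []"
        using L Cons sortable_bound[OF *, of "hd L'"] by (cases L') auto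
      with Cons L * show ?thesis using sortable.pop_r[OF *] by simp
    qed
    from sortable.pop_l[OF this] Nil x show ?thesis by simp
  next
    case (snoc R' a)
    with pop_r have "sortable n (Suc t) w (rev R' @ x # (i # e @ [j]) @ rev L)" by auto
    then show ?thesis using snoc pop_r.hyps(3) sortable.pop_l[of n t w] by simp
  qed
qed auto

section \<open>Sandwiches created at the right end\<close>

lemma sandwich_snoc_if_not_increasing:
  assumes "\<not> sorted_wrt (<) d" "distinct d" "last d < y"
  shows "sandwich (d @ [y])"
proof -
  from assms(1) obtain p q where pq: "p < q" "q < length d" "\<not> d ! p < d ! q"
    by (auto simp: sorted_wrt_iff_nth_less)
  with assms(2) have less: "d ! q < d ! p"
    by (metis less_trans linorder_neqE_nat nat_neq_iff nth_eq_iff_index_eq)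
  obtain q' where q': "p < q'" "q' < length d" "d ! q' < d ! p" "d ! q' < y"
  proof (cases "d ! q < y")
    case True
    with pq less that show ?thesis by blast
  next
    case False
    have "d ! (length d - 1) = last d" using pq by (metis last_conv_nth length_0_conv not_less0)
    \<comment> \<open>Here \<open>last d < y \<le> d ! q < d ! p\<close>, so the last element of
      \<open>d\<close> is itself sandwiched between \<open>d ! p\<close> and
      \<open>y\<close>.\<close>
    with False less pq assms(3) show ?thesis by (intro that[of "length d - 1"]) auto
  qed
  then show ?thesis unfolding sandwich_def
    by (intro exI[of _ p] exI[of _ q'] exI[of _ "length d"]) (simp add: nth_append)
qed

text \<open>A new sandwich needs \<open>z\<close> on its right and a descent in \<open>d\<close>. If
  \<open>z < last d\<close>, then \<open>last d\<close> can replace \<open>z\<close>, giving a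
  sandwich already in \<open>d\<close>.\<close>

lemma not_sandwich_snoc:
  assumes "\<not> sandwich d" "sorted_wrt (<) d \<or> z < last d"
  shows "\<not> sandwich (d @ [z])"
proof
  assume "sandwich (d @ [z])"
  then obtain p q r where pqr: "p < q" "q < r" "r < Suc (length d)"
    "(d @ [z]) ! q < (d @ [z]) ! p" "(d @ [z]) ! q < (d @ [z]) ! r"
    unfolding sandwich_def by auto
  show False
  proof (cases "r < length d")
    case True
    with pqr have "d ! q < d ! p" "d ! q < d ! r" by (auto simp: nth_append)
    with True pqr assms(1) show False unfolding sandwich_def by blast
  next
    case False
    with pqr have *: "q < length d" "d ! q < d ! p" "d ! q < z"
      by (auto simp: nth_append split: if_splits)
    from * pqr(1) have "\<not> sorted_wrt (<) d"
      by (meson less_asym sorted_wrt_nth_less)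
    with assms(2) have "z < last d" by simp
    then have last: "z < d ! (length d - 1)" using *(1) by (metis last_conv_nth length_0_conv not_less0)
    with *(3) have "q \<noteq> length d - 1" by force
    with *(1) have "q < length d - 1" by simp
    moreover have "length d - 1 < length d" using *(1) by simp
    moreover have "d ! q < d ! (length d - 1)" using *(3) last by simp
    ultimately show False
      using *(2) pqr(1) assms(1) unfolding sandwich_def by blast
  qed
qed

section \<open>Characterisation of substantive choices\<close>

lemma substantive_choice_sortable:
  "substantive_choice n t d x \<longleftrightarrow>
    (\<exists>w. completion n t d x w \<and> sortable n t w (x # d) \<and> \<not> sortable n t w (d @ [x])) \<and>
    (\<exists>w. completion n t d x w \<and> sortable n t w (d @ [x]) \<and> \<not> sortable n t w (x # d))"
  unfolding substantive_choice_def can_be_sorted_iff_sortable ..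

lemma hd_less_if_hd_less_last:
  assumes "\<not> sandwich (i # e @ [j])" "distinct (i # e @ [j])" "i < j" "b \<in> set (e @ [j])"
  shows "i < b"
proof -
  let ?d = "i # e @ [j]"
  have "\<forall>b\<in>set ?d. Min (set ?d) \<le> b" by (blast intro: Min_le)
  with min_at_end[OF assms(1) _ _ assms(2)] have "Min (set ?d) = i \<or> Min (set ?d) = j"
    by (metis Min_in finite_set last.simps last_snoc list.distinct(1) list.sel(1) set_empty snoc_eq_iff_butlast)
  moreover have "Min (set ?d) \<le> i" by simp
  ultimately have "Min (set ?d) = i" using assms(3) by linarith
  moreover have "Min (set ?d) \<le> b" using assms(4) by (intro Min_le) auto
  ultimately show ?thesis using assms(2,4) by (auto simp: less_le)
qed

text \<open>A failing condition contradicts \<open>w1\<close>, sortable only with \<open>x\<close>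
  next to \<open>i\<close>, or \<open>w2\<close>, sortable only with \<open>x\<close> next to
  \<open>j\<close>.\<close>

lemma substantive_choice_necessary:
  assumes "game_position n t d x" "\<not> sandwich d" "d = i # e @ [j]" "i < j"
    and "substantive_choice n t d x"
  shows "x < i \<and> 3 \<le> i - x \<and> x \<noteq> Suc t \<and> (\<exists>y \<in> unrevealed n t d x. i < y) \<and>
    (\<not> monotonic d \<longrightarrow> (\<exists>z \<in> unrevealed n t d x. i < z \<and> z < j))"
proof -
  have d: "distinct d" "x \<notin> set d" using assms(1) unfolding game_position_def by auto
  have min: "i \<le> b" if "b \<in> set d" for b
    using hd_less_if_hd_less_last[of i e j b] assms d that by auto
  obtain w1 w2 where w1: "completion n t d x w1" "sortable n t w1 (x # d)"
      "\<not> sortable n t w1 (d @ [x])"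
    and w2: "completion n t d x w2" "sortable n t w2 (d @ [x])" "\<not> sortable n t w2 (x # d)"
    using assms(5) unfolding substantive_choice_sortable by blast
  have "x < i"
    using sandwichI[of i x j "[]" "[]" e "[]"] sandwich_not_sortable[OF w1(2)] assms(3,4) d(2)
    by (cases x i rule: linorder_cases) auto
  have "3 \<le> i - x"
  proof (rule ccontr)
    assume "\<not> 3 \<le> i - x"
    moreover have "i \<notin> set w2" using w2(1) assms(3) unfolding completion_def unrevealed_def by auto
    ultimately show False
      using sortable_move_to_smaller_end[of n t w2 "[]" i e j x "[]"] w2 assms(3,4) \<open>x < i\<close> by simp
  qed
  have "x \<noteq> Suc t"
    using sortable_remove_next[of n t w1 "[]" d] sortable.pop_r[of n t w1 d] w1 by auto
  \<comment> \<open>Otherwise flipping the left stack \<open>[x]\<close> to the right would make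
    \<open>w1\<close> sortable after \<open>d @ [x]\<close>.\<close>
  have "\<not> (\<forall>y \<in> set w1. (\<forall>b \<in> set d. y < b) \<or> sandwich (y # d) \<and> sandwich (d @ [y]))"
    using sortable_flip[of n t w1 "[x]" d "[]"] w1 assms(3) min \<open>x < i\<close> by fastforce
  then obtain y where y: "y \<in> unrevealed n t d x" "\<not> (\<forall>b \<in> set d. y < b)"
      "\<not> (sandwich (y # d) \<and> sandwich (d @ [y]))"
    using w1(1) unfolding completion_def by blast
  have "y \<notin> set d" using y(1) unfolding unrevealed_def by simp
  then have "i < y" "y \<noteq> j" using min y(2) assms(3) by (force simp: not_less)+
  moreover have "y < j" if "\<not> monotonic d"
  proof (rule ccontr)
    assume "\<not> y < j"
    with \<open>y \<noteq> j\<close> have "last d < y" using assms(3) by simp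
    with that have "sandwich (d @ [y])"
      using sandwich_snoc_if_not_increasing d(1) unfolding monotonic_def by blast
    moreover have "sandwich (y # d)"
      using sandwichI[of i y j "[]" "[]" e "[]"] \<open>i < y\<close> assms(3,4) by simp
    ultimately show False using y(3) by blast
  qed
  ultimately show ?thesis using y(1) \<open>x < i\<close> \<open>3 \<le> i - x\<close> \<open>x \<noteq> Suc t\<close> by blast
qed

lemma substantive_choice_sufficient:
  assumes "game_position n t d x" "\<not> sandwich d" "d = i # e @ [j]" "i < j"
    and "x < i" "3 \<le> i - x" "x \<noteq> Suc t" "\<exists>y \<in> unrevealed n t d x. i < y"
    and "\<not> monotonic d \<longrightarrow> (\<exists>z \<in> unrevealed n t d x. i < z \<and> z < j)"
  shows "substantive_choice n t d x"
proof -
  have d: "distinct d" "x \<notin> set d" "set d \<subseteq> {t<..n}" "t < x" "x \<le> n"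
    using assms(1) unfolding game_position_def by auto
  have min: "i \<le> b" if "b \<in> set d" for b
    using hd_less_if_hd_less_last[of i e j b] assms d that by auto
  have unrevealed: "unrevealed n t d x = {t<..n} - set d - {x}"
    using d unfolding unrevealed_def by auto
  have "i \<le> n" using assms(3) d by auto
  from d(4) assms(7) obtain s where s: "x = Suc s" "Suc t \<le> s"
    by (cases x) auto
  have "\<not> sorted_wrt (>) d" using assms(3,4) by auto
  \<comment> \<open>Since \<open>i < j\<close>, a monotonic \<open>d\<close> is increasing, and then
    any unrevealed \<open>z\<close> above \<open>i\<close> can still go on the right of
    \<open>d\<close>.\<close>
  with assms(8,9) obtain z where z: "i < z" "z \<in> unrevealed n t d x" "sorted_wrt (<) d \<or> z < j"
    unfolding monotonic_def by blast
  have z': "z \<notin> set d" "z \<le> n" using z(2) unrevealed by auto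
  have dz: "\<not> sandwich (d @ [z])" using not_sandwich_snoc[OF assms(2)] z(3) assms(3) by simp
  let ?w1 = "z # sorted_list_of_set ({t<..n} - set (x # d @ [z]))"
  \<comment> \<open>The set starts above \<open>x\<close> because \<open>1, ..., x\<close> can be
    output before \<open>z\<close> is placed.\<close>
  let ?r = "sorted_list_of_set ({x<..n} - set ((x + 2) # d @ [z]))"
  let ?w2 = "(x + 2) # [Suc t..<x] @ z # ?r"
  \<comment> \<open>On the left of \<open>d\<close>, \<open>z\<close> sandwiches \<open>i\<close>;
    on the right, it sandwiches any \<open>a < i\<close> lying on top of \<open>j\<close>.\<close>
  have blocked: "sandwich (z # d)" "sandwich (d @ [a] @ [z])" if "a < i" for a
    using sandwichI[of i z j "[]" "[]" e "[]"] sandwichI[of a j z "i # e" "[]" "[]" "[]"]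
      that z(1) assms(3,4) by auto
  have "x + 2 < i" using assms(6) by linarith
  have "completion n t d x ?w1"
    using z(2) unfolding completion_def unrevealed by auto
  moreover have "sortable n t ?w1 (x # d)"
  proof (rule push_r)
    have "\<not> sandwich (x # d @ [z])"
      using dz min z(1) assms(5) by (intro not_sandwich_Cons_min) (auto dest: order_less_le_trans)
    then show "sortable n t (sorted_list_of_set ({t<..n} - set (x # d @ [z]))) ((x # d) @ [z])"
      using sortable_increasing_input[of t n "x # d @ [z]"] d z z' assms(5) by auto
  qed
  moreover have "\<not> sortable n t ?w1 (d @ [x])"
  proof
    assume "sortable n t ?w1 (d @ [x])"
    moreover have "Suc t \<notin> set (d @ [x])" using min s assms(5) by fastforce
    ultimately show False
      by (rule sortable_push_cases)
        (use blocked[OF assms(5)] sandwich_append[of "z # d" "[]" "[x]"] sandwich_not_sortable in auto)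
  qed
  moreover have "completion n t d x ?w2"
  proof -
    have "\<forall>b \<in> set d. x + 2 < b"
      using min assms(6) by fastforce
    moreover have "x + 2 < z" using z(1) assms(6) by linarith
    ultimately show ?thesis
      using z z' d \<open>i \<le> n\<close> assms(6) unfolding completion_def unrevealed
      by (auto simp: not_less dest: bspec)
  qed
  moreover have "sortable n t ?w2 (d @ [x])"
  proof -
    \<comment> \<open>With \<open>x + 2\<close> on top of \<open>i\<close>, the right end becomes
      free for \<open>z\<close> as soon as \<open>x\<close> is output; the increasing rest then
      succeeds.\<close>
    have "\<not> sandwich ((x + 2) # d @ [z])"
      using dz min z(1) assms(6) by (intro not_sandwich_Cons_min) (auto dest: min)
    then have "sortable n x ?r ((x + 2) # d @ [z])"
      using sortable_increasing_input[of x n "(x + 2) # d @ [z]"] d z z' assms(6) min \<open>i \<le> n\<close>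
      by fastforce
    then have "sortable n (Suc s) (z # ?r) ((x + 2) # d)"
      using s by (intro push_r) simp
    then have "sortable n s (z # ?r) ((x + 2) # d @ [x])"
      using pop_r[of n s "z # ?r" "(x + 2) # d"] s by simp
    then have "sortable n t ([Suc t..<x] @ z # ?r) ((x + 2) # d @ [x])"
      using sortable_pass_interval[of t s] s by simp
    then show ?thesis by (rule push_l)
  qed
  moreover have "\<not> sortable n t ?w2 (x # d)"
  proof
    assume "sortable n t ?w2 (x # d)"
    moreover have "Suc t \<notin> set (x # d)" using min s assms(5) by fastforce
    ultimately show False
    proof (rule sortable_push_cases)
      \<comment> \<open>Here \<open>x\<close> is sandwiched between \<open>x + 2\<close> and
        \<open>i\<close>.\<close>
      assume "sortable n t ([Suc t..<x] @ z # ?r) ((x + 2) # x # d)"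
      then show False
        using sandwichI[of x "x + 2" i "[]" "[]" "[]"] sandwich_not_sortable assms(3,5) by fastforce
    next
      assume "sortable n t ([Suc t..<x] @ z # ?r) ((x # d) @ [x + 2])"
      then have "sortable n s (z # ?r) ([] @ Suc s # d @ [x + 2])"
        using sortable_pass_interval[of t s] s by simp
      from sortable_remove_next[OF this] have "sortable n x (z # ?r) (d @ [x + 2])"
        using s by simp
      \<comment> \<open>The next output \<open>x + 1\<close> is still behind \<open>z\<close> in the
        input, so \<open>x + 2\<close> cannot leave before \<open>z\<close> is placed. In its place
        \<open>x + 1\<close> could be popped at once, hence the gap of 3.\<close>
      moreover have "Suc x \<notin> set (d @ [x + 2])" using min assms(6) by fastforce
      ultimately show False
        by (rule sortable_push_cases)
          (use blocked[OF \<open>x + 2 < i\<close>] sandwich_append[of "z # d" "[]" "[x + 2]"]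
            sandwich_not_sortable in auto)
    qed
  qed
  ultimately show ?thesis unfolding substantive_choice_sortable by blast
qed

text \<open>Mirroring swaps the two placements and so the two halves of the definition; this reduces
  the theorem to \<open>hd d < last d\<close>.\<close>

lemma substantive_choice_rev: "substantive_choice n t (rev d) x \<longleftrightarrow> substantive_choice n t d x"
proof -
  have "sortable n t w (x # rev d) \<longleftrightarrow> sortable n t w (d @ [x])"
    "sortable n t w (rev d @ [x]) \<longleftrightarrow> sortable n t w (x # d)" for w
    using sortable_rev[of n t w "d @ [x]"] sortable_rev[of n t w "x # d"] by simp_all
  then show ?thesis
    unfolding substantive_choice_sortable completion_def unrevealed_def by auto
qed

theorem theorem10p2:
  fixes n t x :: nat and d :: "nat list"
  assumes "game_position n t d x"
    and "\<not> sandwich d"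
  shows "substantive_choice n t d x \<longleftrightarrow>
    2 \<le> length d \<and>
    (let i = min (hd d) (last d); j = max (hd d) (last d) in
       x < i \<and>
       i - x \<ge> 3 \<and>
       x \<noteq> t + 1 \<and>
       (\<exists>y \<in> unrevealed n t d x. i < y) \<and>
       (\<not> monotonic d \<longrightarrow> (\<exists>z \<in> unrevealed n t d x. i < z \<and> z < j)))"
    (is "_ \<longleftrightarrow> _ \<and> ?conditions d")
proof (cases "2 \<le> length d")
  case False
  \<comment> \<open>A deque with at most one element is its own mirror image, so both placements are
    equivalent.\<close>
  then have "rev d = d" by (cases d; cases "tl d") auto
  then have "sortable n t w (x # d) \<longleftrightarrow> sortable n t w (d @ [x])" for w
    using sortable_rev[of n t w "x # d"] by simp
  with False show ?thesis unfolding substantive_choice_sortable by simp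
next
  case True
  have increasing_ends: "substantive_choice n t d x \<longleftrightarrow> ?conditions d"
    if "game_position n t d x" "\<not> sandwich d" "2 \<le> length d" "hd d < last d" for d
  proof -
    from that(3) obtain i e j where d: "d = i # e @ [j]"
      by (cases d; cases "tl d" rule: rev_cases) auto
    with that(4) have "i < j" by simp
    with substantive_choice_necessary[OF that(1,2) d] substantive_choice_sufficient[OF that(1,2) d]
    show ?thesis using d by (auto simp: Let_def)
  qed
  have "distinct d" using assms(1) unfolding game_position_def by simp
  with True have "hd d \<noteq> last d" by (cases d) (auto split: if_splits)
  then consider "hd d < last d" | "last d < hd d" by linarith
  then show ?thesis
  proof cases
    case 1
    with increasing_ends[OF assms True] True show ?thesis by simp
  next
    case 2
    have "d \<noteq> []" using True by auto
    have "?conditions (rev d) \<longleftrightarrow> ?conditions d"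
      using \<open>d \<noteq> []\<close>
      by (simp add: hd_rev last_rev min.commute max.commute monotonic_def sorted_wrt_rev
          unrevealed_def disj_commute)
    moreover have "substantive_choice n t (rev d) x \<longleftrightarrow> ?conditions (rev d)"
      using assms True 2 \<open>d \<noteq> []\<close>
      by (intro increasing_ends) (auto simp: game_position_def sandwich_rev hd_rev last_rev)
    ultimately show ?thesis using True by (simp add: substantive_choice_rev)
  qed
qed

end
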